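(* Let $b,c,\nu,\rho\in\mathbb{C}$ with $\operatorname{Re}(c)>0$, $\operatorname{Re}(\nu)>-\tfrac12$, $\operatorname{Re}(\rho)>0$, and let $z\in\mathbb{C}\setminus(-\infty,0]$. Then $$\begin{aligned}G_\nu^{(b,c)}(z;\rho)=\;&\frac{(z/2)^\nu}{\Gamma(c)\,\pi\,[\Gamma(\nu+\frac12)]^2}\int_0^1\!\!\int_0^1\!\!\int_0^1 t^{-\frac12}u^{-\frac12}s^{c+\nu-1}(1-t)^{\nu-\frac12}(1-u)^{\nu-\frac12}(1-s)^{-c-\nu-1}\\ &\times e^{\frac{-s^2-\rho(1-s)^2}{s(1-s)}}\;{}_0F_3\Big(-;\tfrac14,\tfrac34,\tfrac12;\tfrac{-bz^2s^2u^2t}{16(1-s)^2}\Big)\,ds\,dt\,du .\end{aligned}$$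
   Context: For $\rho\in\mathbb{C}$ with $\operatorname{Re}(\rho)>0$ and $x\in\mathbb{C}$ put $\Gamma_\rho(x)=\int_0^\infty t^{x-1}e^{-t-\rho/t}\,dt$. The generalized Pochhammer symbol is $(\lambda;\rho)_\nu:=\Gamma_\rho(\lambda+\nu)/\Gamma(\lambda)$. The unified four parameter Bessel function is $$G_\nu^{(b,c)}(z;\rho):=\sum_{k=0}^\infty \frac{(-b)^k (c;\rho)_{2k+\nu}}{\Gamma(\nu+k+1)\,\Gamma(\nu+2k+1)}\,\frac{(z/2)^{2k+\nu}}{k!}.$$ Complex powers are principal. Also ${}_0F_3(-;a_1,a_2,a_3;x)=\sum_{k=0}^\infty \frac{1}{(a_1)_k(a_2)_k(a_3)_k}\frac{x^k}{k!}$ with $(a)_k=\Gamma(a+k)/\Gamma(a)$. *)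

theory Defs
  imports "HOL-Analysis.Analysis"
begin

text \<open>
  Meant for \<open>Re \<rho> > 0\<close>, where the integral converges absolutely for every complex \<open>x\<close>.
\<close>

definition Gamma_ext :: "complex \<Rightarrow> complex \<Rightarrow> complex" where
  "Gamma_ext \<rho> x =
     (LBINT t:{0<..}. complex_of_real t powr (x - 1) *
        exp (- complex_of_real t - \<rho> / complex_of_real t))"

definition pochhammer_ext :: "complex \<Rightarrow> complex \<Rightarrow> complex \<Rightarrow> complex" where
  "pochhammer_ext \<mu> \<rho> \<nu> = Gamma_ext \<rho> (\<mu> + \<nu>) / Gamma \<mu>"

definition Bessel_G_term ::
  "complex \<Rightarrow> complex \<Rightarrow> complex \<Rightarrow> complex \<Rightarrow> complex \<Rightarrow> nat \<Rightarrow> complex" where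
  "Bessel_G_term \<nu> b c z \<rho> k =
     (- b) ^ k * pochhammer_ext c \<rho> (2 * of_nat k + \<nu>) /
       (Gamma (\<nu> + of_nat k + 1) * Gamma (\<nu> + 2 * of_nat k + 1)) *
     ((z / 2) powr (2 * of_nat k + \<nu>) / fact k)"

definition Bessel_G ::
  "complex \<Rightarrow> complex \<Rightarrow> complex \<Rightarrow> complex \<Rightarrow> complex \<Rightarrow> complex" where
  "Bessel_G \<nu> b c z \<rho> = (\<Sum>k. Bessel_G_term \<nu> b c z \<rho> k)"

text \<open>
  The quotient \<open>Gamma (a + k) / Gamma a\<close> is the library's \<open>pochhammer a k\<close> whenever \<open>a\<close> is not
  a non-positive integer; see the lemma \<open>pochhammer_Gamma\<close>.
\<close>

definition hypergeom_0F3 :: "complex \<Rightarrow> complex \<Rightarrow> complex \<Rightarrow> complex \<Rightarrow> complex" where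
  "hypergeom_0F3 a\<^sub>1 a\<^sub>2 a\<^sub>3 x =
     (\<Sum>k. 1 / (pochhammer a\<^sub>1 k * pochhammer a\<^sub>2 k * pochhammer a\<^sub>3 k) * (x ^ k / fact k))"

end

theory Submission
  imports Defs
begin

text \<open>
  The triple integrand is a product of three one-variable kernels times a power series in a
  product: with \<open>X = (s / (1 - s))\<^sup>2\<close> and \<open>q = - b z\<^sup>2 / 16\<close> it is
  \<open>h(s) B(t) B(u) \<Sum>k. e\<^sub>k q\<^sup>k (X t u\<^sup>2)\<^sup>k\<close>, where \<open>e\<^sub>k\<close> are the coefficients of the
  hypergeometric series. Integrating term by term therefore multiplies the \<open>k\<close>-th coefficient
  by one moment for each variable. The substitution \<open>x = s / (1 - s)\<close> turns the \<open>s\<close>-moment into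
  \<open>Gamma_ext \<rho> (c + \<nu> + 2 k)\<close> (lemma \<open>integral_unit_kernel_power\<close>), and the other two moments
  are the Beta values \<open>Beta (k + 1/2) (\<nu> + 1/2)\<close> and \<open>Beta (2 k + 1/2) (\<nu> + 1/2)\<close> (lemma
  \<open>integral_beta_kernel_power\<close>). Their numerators \<open>Gamma (k + 1/2) Gamma (2 k + 1/2)\<close> cancel the
  hypergeometric denominators up to \<open>\<pi> 4\<^sup>k / k!\<close> by the duplication formula
  (lemma \<open>Gamma_half_quarters\<close>), and what remains is the \<open>k\<close>-th term of the Bessel series.

  Convergence rests on the collapse
  \<open>(1/4)\<^sub>k (3/4)\<^sub>k (1/2)\<^sub>k k! = (4 k)! / 256\<^sup>k\<close>: the hypergeometric function at a point of
  modulus \<open>y\<close> is bounded by every fourth term of an exponential series, hence by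
  \<open>exp (4 y\<^bsup>1/4\<^esup>)\<close>. As \<open>y\<close> grows like \<open>x\<^sup>2\<close> in the variable \<open>x = s / (1 - s)\<close>, this
  is only \<open>exp (K sqrt x)\<close>, which the factor \<open>exp (- x)\<close> of the kernel absorbs. One integrable
  majorant \<open>D(s)\<close> (lemma \<open>unit_kernel_majorant\<close>) then serves both purposes: it licenses the
  exchange of sum and integral (lemma \<open>integral_power_series\<close>), which also yields the absolute
  convergence of the Bessel series, and \<open>D(s) \<bar>B(t)\<bar> \<bar>B(u)\<bar>\<close> dominates the integrand on the cube.
\<close>

section \<open>Measurability and product integrands\<close>

lemma (in pair_sigma_finite) integrable_mult_prod:
  fixes f g :: "_ \<Rightarrow> 'c :: {real_normed_field, banach, second_countable_topology}"
  assumes f: "integrable M1 f" and g: "integrable M2 g"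
  shows "integrable (M1 \<Otimes>\<^sub>M M2) (\<lambda>(x, y). f x * g y)"
proof (rule Fubini_integrable)
  note [measurable] = borel_measurable_integrable[OF f] borel_measurable_integrable[OF g]
  show "(\<lambda>(x, y). f x * g y) \<in> borel_measurable (M1 \<Otimes>\<^sub>M M2)"
    by measurable
  show "integrable M1 (\<lambda>x. \<integral>y. norm (case (x, y) of (x, y) \<Rightarrow> f x * g y) \<partial>M2)"
    using f by (simp add: norm_mult)
  show "AE x in M1. integrable M2 (\<lambda>y. case (x, y) of (x, y) \<Rightarrow> f x * g y)"
    using g by simp
qed

lemma set_integrable_lborel_iff:
  fixes f :: "'a :: euclidean_space \<Rightarrow> 'b :: {banach, second_countable_topology}"
  assumes "S \<in> sets borel" "continuous_on S f"
  shows "f absolutely_integrable_on S \<longleftrightarrow> set_integrable lborel S f"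
  unfolding set_integrable_def
  using borel_measurable_continuous_on_indicator[OF assms]
  by (intro integrable_completion) simp

lemma set_borel_measurable_lborel_continuous:
  fixes f :: "'a :: euclidean_space \<Rightarrow> 'b :: {banach, second_countable_topology}"
  assumes "S \<in> sets borel" "continuous_on S f"
  shows "set_borel_measurable lborel S f"
  unfolding set_borel_measurable_def
  using borel_measurable_continuous_on_indicator[OF assms] by simp

section \<open>The Beta integral for complex parameters\<close>

lemma nonpos_Ints_imp_Re_nonpos: "z \<in> \<int>\<^sub>\<le>\<^sub>0 \<Longrightarrow> Re z \<le> 0"
  by (elim nonpos_Ints_cases) simp

text \<open>
  The integrand of the Gamma integral extended by zero to the real line, so that translations and
  dilations of the whole line act on it without case distinctions on domains of integration.
\<close>

definition Gamma_density :: "complex \<Rightarrow> real \<Rightarrow> complex" where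
  "Gamma_density a t = indicator {0<..} t *\<^sub>R (of_real t powr (a - 1) / of_real (exp t))"

lemma has_bochner_integral_Gamma_density:
  assumes "Re a > 0"
  shows "has_bochner_integral lborel (Gamma_density a) (Gamma a)"
proof -
  have "set_integrable lborel {0<..} (\<lambda>t. complex_of_real t powr (a - 1) / of_real (exp t))"
    using absolutely_integrable_Gamma_integral'[OF assms]
    by (subst (asm) set_integrable_lborel_iff) (auto intro!: continuous_intros)
  moreover from set_borel_integral_eq_integral(2)[OF this]
  have "(LBINT t:{0<..}. complex_of_real t powr (a - 1) / of_real (exp t)) = Gamma a"
    using Gamma_integral_complex'[OF assms] by (simp add: integral_unique)
  ultimately show ?thesis
    by (simp add: has_bochner_integral_iff set_integrable_def set_lebesgue_integral_def
        Gamma_density_def [abs_def])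
qed

text \<open>
  \<open>Gamma a * Gamma b\<close> is the total mass of the convolution of two Gamma densities. At a point
  \<open>u > 0\<close>, scaling by \<open>u\<close> shows the convolution to be the Gamma density for \<open>a + b\<close> times the
  Beta integral, which therefore equals \<open>Gamma a * Gamma b / Gamma (a + b)\<close>.
\<close>

theorem integral_Beta_complex:
  fixes a b :: complex
  assumes a: "Re a > 0" and b: "Re b > 0"
  shows "set_integrable lborel {0<..<1}
           (\<lambda>t. complex_of_real t powr (a - 1) * (1 - complex_of_real t) powr (b - 1))"
    and "(LBINT t:{0<..<1}. complex_of_real t powr (a - 1) * (1 - complex_of_real t) powr (b - 1))
           = Beta a b"
proof -
  let ?f = "\<lambda>t::real. complex_of_real t powr (a - 1) * (1 - complex_of_real t) powr (b - 1)"
  let ?G = Gamma_density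
  have "set_integrable lborel {0<..<1} (\<lambda>t. t powr (Re a - 1) * (1 - t) powr (Re b - 1))"
    using integrable_Beta[OF a b] by (rule set_integrable_subset) auto
  then show "set_integrable lborel {0<..<1} ?f"
  proof (rule set_integrable_bound)
    show "set_borel_measurable lborel {0<..<1} ?f"
      by (intro set_borel_measurable_lborel_continuous continuous_intros)
        (auto simp: complex_nonpos_Reals_iff)
    have "norm (?f t) = t powr (Re a - 1) * (1 - t) powr (Re b - 1)" if "t \<in> {0<..<1}" for t
    proof -
      have "norm ((1 - complex_of_real t) powr (b - 1)) = (1 - t) powr (Re b - 1)"
        using that by (subst norm_powr_real_powr) auto
      then show ?thesis
        using that by (simp add: norm_mult norm_powr_real_powr)
    qed
    then show "AE t in lborel. t \<in> {0<..<1} \<longrightarrow>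
        norm (?f t) \<le> norm (t powr (Re a - 1) * (1 - t) powr (Re b - 1))"
      by (auto simp del: norm_mult)
  qed
  have Ga: "integrable lborel (?G a)" "integral\<^sup>L lborel (?G a) = Gamma a"
    and Gb: "integrable lborel (?G b)" "integral\<^sup>L lborel (?G b) = Gamma b"
    and Gab: "integral\<^sup>L lborel (?G (a + b)) = Gamma (a + b)"
    using has_bochner_integral_Gamma_density[of a] has_bochner_integral_Gamma_density[of b]
      has_bochner_integral_Gamma_density[of "a + b"] a b
    by (auto simp: has_bochner_integral_iff)
  have shift: "integrable lborel (\<lambda>u. ?G b (u - t))"
    "(\<integral>u. ?G b (u - t) \<partial>lborel) = Gamma b"
    "(\<integral>u. norm (?G b (u - t)) \<partial>lborel) = (\<integral>u. norm (?G b u) \<partial>lborel)" for t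
    using lborel_integrable_real_affine[OF Gb(1), of 1 "- t"]
      lborel_integral_real_affine[of 1 "?G b" "- t"] Gb(2)
      lborel_integral_real_affine[of 1 "\<lambda>u. norm (?G b u)" "- t"]
    by (simp_all add: algebra_simps)
  have meas [measurable]: "?G a \<in> borel_measurable borel" "?G b \<in> borel_measurable borel"
    using Ga(1) Gb(1) by (auto dest: borel_measurable_integrable)
  \<comment> \<open>Integrating the norm over \<open>u\<close> first is a mere translation, which gives absolute
    integrability of the convolution kernel and allows the order to be exchanged.\<close>
  have conv: "integrable (lborel \<Otimes>\<^sub>M lborel) (\<lambda>(t, u). ?G a t * ?G b (u - t))"
  proof (rule lborel_pair.Fubini_integrable)
    show "(\<lambda>(t, u). ?G a t * ?G b (u - t)) \<in> borel_measurable (lborel \<Otimes>\<^sub>M lborel)"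
      by measurable
    show "integrable lborel (\<lambda>t. \<integral>u. norm (case (t, u) of (t, u) \<Rightarrow> ?G a t * ?G b (u - t)) \<partial>lborel)"
      using Ga(1) by (simp add: norm_mult shift(3))
    show "AE t in lborel. integrable lborel (\<lambda>u. case (t, u) of (t, u) \<Rightarrow> ?G a t * ?G b (u - t))"
      using shift(1) by simp
  qed
  have inner: "(\<integral>t. ?G a t * ?G b (u - t) \<partial>lborel) = ?G (a + b) u * (LBINT s:{0<..<1}. ?f s)" for u
  proof (cases "u > 0")
    case False
    then have zero: "?G a t * ?G b (u - t) = 0" for t
      by (auto simp: Gamma_density_def indicator_def)
    show ?thesis
      using False by (simp add: zero) (simp add: Gamma_density_def)
  next
    case True
    have split: "?G a (u * s) * ?G b (u - u * s)
        = (?G (a + b) u / of_real u) * (indicator {0<..<1} s *\<^sub>R ?f s)" for s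
    proof (cases "0 < s \<and> s < 1")
      case s: True
      have 1: "complex_of_real u * (1 - of_real s) = of_real u - of_real u * of_real s"
        by (simp add: algebra_simps)
      have "complex_of_real (u * s) powr (a - 1) = of_real u powr (a - 1) * of_real s powr (a - 1)"
        using True s by (simp add: powr_times_real)
      moreover have "complex_of_real (u - u * s) powr (b - 1)
          = of_real u powr (b - 1) * (1 - of_real s) powr (b - 1)"
        using True s powr_times_real[of "of_real u" "1 - of_real s" "b - 1"]
        by (simp add: 1)
      moreover have "complex_of_real u powr (a - 1) * of_real u powr (b - 1)
          = of_real u powr (a + b - 1) / of_real u"
        using True by (simp add: powr_diff powr_add field_simps power2_eq_square)
      moreover have "complex_of_real (exp (u * s)) * of_real (exp (u - u * s)) = of_real (exp u)"
        by (simp flip: of_real_mult exp_add)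
      ultimately show ?thesis
        using True s by (simp add: Gamma_density_def field_simps mult_less_cancel_left1)
    next
      case s: False
      then have "\<not> (0 < u * s \<and> 0 < u - u * s)"
        using True by (auto simp: zero_less_mult_iff)
      then show ?thesis
        using s by (auto simp: Gamma_density_def indicator_def)
    qed
    have "(\<integral>t. ?G a t * ?G b (u - t) \<partial>lborel) = u *\<^sub>R (\<integral>s. ?G a (u * s) * ?G b (u - u * s) \<partial>lborel)"
      using lborel_integral_real_affine[of u "\<lambda>t. ?G a t * ?G b (u - t)" 0] True by simp
    then show ?thesis
      using True
      by (simp only: split integral_mult_right_zero set_lebesgue_integral_def)
        (simp add: scaleR_conv_of_real)
  qed
  have "Gamma a * Gamma b = (\<integral>t. \<integral>u. ?G a t * ?G b (u - t) \<partial>lborel \<partial>lborel)"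
    by (simp add: shift(2) Ga(2))
  also have "\<dots> = (\<integral>u. \<integral>t. ?G a t * ?G b (u - t) \<partial>lborel \<partial>lborel)"
    using lborel_pair.Fubini_integral[of "\<lambda>t u. ?G a t * ?G b (u - t)"] conv by simp
  also have "\<dots> = Gamma (a + b) * (LBINT s:{0<..<1}. ?f s)"
    by (simp add: inner Gab)
  finally have "Gamma a * Gamma b = Gamma (a + b) * (LBINT s:{0<..<1}. ?f s)" .
  moreover have "Gamma (a + b) \<noteq> 0"
    using a b Gamma_eq_zero_iff[of "a + b"] by (auto dest!: nonpos_Ints_imp_Re_nonpos)
  ultimately show "(LBINT t:{0<..<1}. ?f t) = Beta a b"
    by (simp add: Beta_def field_simps)
qed

section \<open>Termwise integration of power series\<close>

text \<open>
  The extra factor \<open>y\<close> stands for the variables that are not being integrated; since \<open>\<bar>y\<bar> \<le> 1\<close>,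
  one majorant \<open>D\<close> works for all of them. Summability of the new coefficients is part of the
  conclusion, so that the result of integrating over one variable can be integrated over the next:
  the partial sums of their norms are bounded by the integral of \<open>D\<close>.
\<close>

lemma
  fixes h A :: "real \<Rightarrow> complex" and D :: "real \<Rightarrow> real" and a :: "nat \<Rightarrow> complex"
  assumes S: "S \<in> sets borel" and h: "continuous_on S h" and A: "continuous_on S A"
    and D: "set_integrable lborel S D"
    and sm: "\<And>x. x \<in> S \<Longrightarrow> summable (\<lambda>k. norm (a k) * norm (A x) ^ k)"
    and le: "\<And>x. x \<in> S \<Longrightarrow> norm (h x) * (\<Sum>k. norm (a k) * norm (A x) ^ k) \<le> D x"
  shows summable_power_series_moments:
      "summable (\<lambda>k. norm (a k * (LBINT x:S. h x * A x ^ k)))" (is ?th1)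
    and integral_power_series:
      "norm y \<le> 1 \<Longrightarrow> (LBINT x:S. h x * (\<Sum>k. a k * (A x * y) ^ k))
         = (\<Sum>k. a k * (LBINT x:S. h x * A x ^ k) * y ^ k)"
proof -
  let ?f = "\<lambda>y k x. indicat_real S x *\<^sub>R (h x * (a k * (A x * y) ^ k))"
  have int_eq: "(\<integral>x. ?f y k x \<partial>lborel) = a k * (LBINT x:S. h x * A x ^ k) * y ^ k" for y k
  proof -
    have "(\<integral>x. ?f y k x \<partial>lborel) = (LBINT x:S. (a k * y ^ k) * (h x * A x ^ k))"
      unfolding set_lebesgue_integral_def
      by (intro Bochner_Integration.integral_cong) (simp_all add: power_mult_distrib mult_ac)
    then show ?thesis
      by (simp only: set_integral_mult_right) (simp add: mult_ac)
  qed
  have bound: "norm (?f y k x) \<le> indicator S x * (norm (h x) * (norm (a k) * norm (A x) ^ k))"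
    if "norm y \<le> 1" for y k x
  proof -
    have "norm y ^ k \<le> 1"
      using that by (simp add: power_le_one)
    then have "norm (a k) * (norm (A x) ^ k * norm y ^ k) \<le> norm (a k) * norm (A x) ^ k"
      by (intro mult_left_mono) (auto intro: mult_left_le)
    then show ?thesis
      by (auto simp: indicator_def norm_mult norm_power power_mult_distrib intro!: mult_left_mono)
  qed
  have sums_le: "(\<Sum>k\<in>K. norm (?f y k x)) \<le> indicator S x * D x"
    if "norm y \<le> 1" "finite K" for y x and K :: "nat set"
  proof (cases "x \<in> S")
    case True
    have "(\<Sum>k\<in>K. norm (?f y k x)) \<le> (\<Sum>k\<in>K. norm (h x) * (norm (a k) * norm (A x) ^ k))"
      using bound[OF that(1), of x] True by (intro sum_mono) simp
    also have "\<dots> \<le> norm (h x) * (\<Sum>k. norm (a k) * norm (A x) ^ k)"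
      unfolding sum_distrib_left[symmetric]
      by (intro mult_left_mono sum_le_suminf sm True that(2)) auto
    also have "\<dots> \<le> D x"
      using le True by simp
    finally show ?thesis
      using True by simp
  qed simp
  have integrable: "integrable lborel (?f y k)" if "norm y \<le> 1" for y k
  proof (rule Bochner_Integration.integrable_bound)
    show "integrable lborel (\<lambda>x. indicator S x * D x)"
      using D by (simp add: set_integrable_def)
    show "?f y k \<in> borel_measurable lborel"
      using set_borel_measurable_lborel_continuous[OF S, of "\<lambda>x. h x * (a k * (A x * y) ^ k)"]
      unfolding set_borel_measurable_def by (simp add: continuous_intros h A)
    show "AE x in lborel. norm (?f y k x) \<le> norm (indicator S x * D x)"
    proof (intro AE_I2)
      fix x
      have "norm (?f y k x) \<le> indicator S x * D x"
        using sums_le[OF that, where K = "{k}" and x = x] by (cases "x \<in> S") simp_all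
      then show "norm (?f y k x) \<le> norm (indicator S x * D x)"
        by (rule order_trans) simp
    qed
  qed
  have summable_int: "summable (\<lambda>k. \<integral>x. norm (?f y k x) \<partial>lborel)" if "norm y \<le> 1" for y
  proof (rule summableI_nonneg_bounded)
    fix n
    have "(\<Sum>k<n. \<integral>x. norm (?f y k x) \<partial>lborel) = (\<integral>x. (\<Sum>k<n. norm (?f y k x)) \<partial>lborel)"
      by (rule Bochner_Integration.integral_sum[symmetric]) (rule integrable_norm[OF integrable[OF that]])
    also have "\<dots> \<le> (\<integral>x. indicator S x * D x \<partial>lborel)"
    proof (rule integral_mono)
      show "integrable lborel (\<lambda>x. \<Sum>k<n. norm (?f y k x))"
        by (intro Bochner_Integration.integrable_sum integrable_norm integrable that)
      show "integrable lborel (\<lambda>x. indicator S x * D x)"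
        using D by (simp add: set_integrable_def)
      show "(\<Sum>k<n. norm (?f y k x)) \<le> indicator S x * D x" for x
        by (intro sums_le that) simp
    qed
    finally show "(\<Sum>k<n. \<integral>x. norm (?f y k x) \<partial>lborel) \<le> (\<integral>x. indicator S x * D x \<partial>lborel)" .
  qed auto
  show ?th1
  proof (rule summable_comparison_test')
    show "summable (\<lambda>k. \<integral>x. norm (?f 1 k x) \<partial>lborel)"
      by (rule summable_int) simp
    show "norm (norm (a k * (LBINT x:S. h x * A x ^ k))) \<le> (\<integral>x. norm (?f 1 k x) \<partial>lborel)" for k
      using integral_norm_bound[of lborel "?f 1 k"] int_eq[where y = 1 and k = k] by simp
  qed
  assume y: "norm y \<le> 1"
  have "(\<Sum>k. a k * (LBINT x:S. h x * A x ^ k) * y ^ k) = (\<integral>x. (\<Sum>k. ?f y k x) \<partial>lborel)"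
    unfolding int_eq[symmetric]
  proof (rule integral_suminf[symmetric])
    show "AE x in lborel. summable (\<lambda>k. norm (?f y k x))"
    proof (intro AE_I2 summableI_nonneg_bounded)
      show "(\<Sum>k<n. norm (?f y k x)) \<le> indicator S x * D x" for x n
        by (intro sums_le y) simp
    qed simp
  qed (use integrable[OF y] summable_int[OF y] in auto)
  also have "\<dots> = (LBINT x:S. h x * (\<Sum>k. a k * (A x * y) ^ k))"
    unfolding set_lebesgue_integral_def
  proof (intro Bochner_Integration.integral_cong refl)
    fix x
    have "summable (\<lambda>k. a k * (A x * y) ^ k)" if x: "x \<in> S"
    proof (rule summable_comparison_test'[OF sm[OF x]])
      show "norm (a k * (A x * y) ^ k) \<le> norm (a k) * norm (A x) ^ k" for k
        using y by (simp add: norm_mult norm_power power_mult_distrib mult_left_le power_le_one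
            mult_left_mono)
    qed
    then show "(\<Sum>k. ?f y k x) = indicat_real S x *\<^sub>R (h x * (\<Sum>k. a k * (A x * y) ^ k))"
      by (cases "x \<in> S") (simp_all add: suminf_mult)
  qed
  finally show "(LBINT x:S. h x * (\<Sum>k. a k * (A x * y) ^ k))
         = (\<Sum>k. a k * (LBINT x:S. h x * A x ^ k) * y ^ k)" ..
qed

section \<open>The hypergeometric function with parameters 1/4, 3/4, 1/2\<close>

text \<open>
  The parameters together with the \<open>1\<close> of the factorial are the four quarters: \<open>k + j / 4\<close> for
  \<open>j = 1, \<dots>, 4\<close> are the quotients by \<open>4\<close> of the four consecutive factors \<open>4 k + j\<close> by which
  \<open>(4 k)!\<close> grows to \<open>(4 (k + 1))!\<close>.
\<close>

lemma pochhammer_quarters: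
  "pochhammer (1/4) k * pochhammer (3/4) k * pochhammer (1/2) k * fact k
     = (fact (4 * k) / 256 ^ k :: 'a :: field_char_0)"
proof (induction k)
  case (Suc k)
  have "fact (4 * Suc k) = (of_nat (4*k+1) * of_nat (4*k+2) * of_nat (4*k+3) * of_nat (4*k+4) * fact (4 * k) :: 'a)"
    by (simp add: eval_nat_numeral algebra_simps)
  also have "\<dots> = 256 ^ Suc k * ((1/4 + of_nat k) * (3/4 + of_nat k) * (1/2 + of_nat k) * of_nat (Suc k))
      * (fact (4 * k) / 256 ^ k)"
    by (simp add: field_simps)
  also have "fact (4 * k) / 256 ^ k = pochhammer (1/4) k * pochhammer (3/4) k * pochhammer (1/2) k * (fact k :: 'a)"
    by (simp add: Suc.IH)
  finally show ?case
    by (simp add: pochhammer_Suc mult_ac)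
qed simp

lemma hypergeom_0F3_quarters:
  "hypergeom_0F3 (1/4) (3/4) (1/2) x = (\<Sum>k. 256 ^ k / fact (4 * k) * x ^ k)"
proof -
  have "1 / (pochhammer (1/4) k * pochhammer (3/4) k * pochhammer (1/2) k) * (x ^ k / fact k)
      = 1 / (pochhammer (1/4) k * pochhammer (3/4) k * pochhammer (1/2) k * fact k) * x ^ k" for k
    by simp
  then show ?thesis
    by (simp only: hypergeom_0F3_def pochhammer_quarters) simp
qed

text \<open>
  With \<open>w = 4 y\<^bsup>1/4\<^esup>\<close> the terms are \<open>w\<^bsup>4k\<^esup> / (4k)!\<close>, a subseries of the exponential
  series at \<open>w\<close>. Growth of order one quarter is what lets the kernel in \<open>s\<close> dominate the series
  near \<open>s = 1\<close>.
\<close>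

lemma
  fixes y :: real
  assumes "y \<ge> 0"
  shows summable_quartic_exp: "summable (\<lambda>k. 256 ^ k / fact (4 * k) * y ^ k)"
    and quartic_exp_le: "(\<Sum>k. 256 ^ k / fact (4 * k) * y ^ k) \<le> exp (4 * y powr (1/4))"
proof -
  define w where "w = 4 * y powr (1/4)"
  have "(y powr (1/4)) ^ 4 = y"
    using assms by (cases "y = 0") (simp_all add: powr_power)
  then have w4: "w ^ 4 = 256 * y"
    by (simp add: w_def power_mult_distrib)
  have terms: "256 ^ k / fact (4 * k) * y ^ k = w ^ (4 * k) /\<^sub>R fact (4 * k)" for k
    unfolding power_mult w4 by (simp add: power_mult_distrib field_simps)
  have w: "w \<ge> 0"
    by (simp add: w_def)
  have inj: "inj (\<lambda>k::nat. 4 * k)"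
    by (auto intro: injI)
  show "summable (\<lambda>k. 256 ^ k / fact (4 * k) * y ^ k)"
    unfolding terms using summable_reindex[OF summable_exp_generic[of w] inj] w by (simp add: o_def)
  have "(\<Sum>k. w ^ (4 * k) /\<^sub>R fact (4 * k)) \<le> (\<Sum>n. w ^ n /\<^sub>R fact n)"
    using suminf_reindex_mono[OF summable_exp_generic[of w] inj] w by (simp add: o_def)
  then show "(\<Sum>k. 256 ^ k / fact (4 * k) * y ^ k) \<le> exp (4 * y powr (1/4))"
    unfolding terms by (simp add: exp_def w_def)
qed

lemma summable_quartic_exp_complex: "summable (\<lambda>k. 256 ^ k / fact (4 * k) * x ^ k :: complex)"
  by (rule summable_norm_cancel)
    (use summable_quartic_exp[of "norm x"] in \<open>simp add: norm_mult norm_divide norm_power\<close>)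

lemma norm_hypergeom_0F3_quarters_le:
  assumes "norm x \<le> r"
  shows "norm (hypergeom_0F3 (1/4) (3/4) (1/2) x) \<le> (\<Sum>k. 256 ^ k / fact (4 * k) * r ^ k)"
proof -
  have "norm (hypergeom_0F3 (1/4) (3/4) (1/2) x) \<le> (\<Sum>k. 256 ^ k / fact (4 * k) * norm x ^ k)"
    unfolding hypergeom_0F3_quarters
    using summable_norm[of "\<lambda>k. 256 ^ k / fact (4 * k) * x ^ k"] summable_quartic_exp[of "norm x"]
    by (simp add: norm_mult norm_divide norm_power)
  also have "\<dots> \<le> (\<Sum>k. 256 ^ k / fact (4 * k) * r ^ k)"
    using assms order_trans[OF norm_ge_zero assms]
    by (intro suminf_le mult_left_mono power_mono summable_quartic_exp) auto
  finally show ?thesis .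
qed

lemma continuous_on_hypergeom_0F3_quarters:
  assumes "continuous_on S f"
  shows "continuous_on S (\<lambda>x. hypergeom_0F3 (1/4) (3/4) (1/2) (f x))"
proof -
  have "isCont (hypergeom_0F3 (1/4) (3/4) (1/2)) x" for x
    using isCont_powser_converges_everywhere[OF summable_quartic_exp_complex, of x]
    by (simp add: hypergeom_0F3_quarters[abs_def])
  then have "continuous_on UNIV (hypergeom_0F3 (1/4) (3/4) (1/2))"
    by (simp add: continuous_on_eq_continuous_at)
  from continuous_on_compose2[OF this assms] show ?thesis
    by simp
qed

text \<open>
  The duplication formula \<open>(1/2)\<^bsub>2k\<^esub> = 4\<^sup>k (1/4)\<^sub>k (3/4)\<^sub>k\<close> matches the two Gamma values with the
  hypergeometric denominators; each of them contributes a factor \<open>sqrt \<pi>\<close>.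
\<close>

lemma Gamma_half_quarters:
  "256 ^ k / fact (4 * k) * (Gamma (of_nat k + 1/2) * Gamma (2 * of_nat k + 1/2))
     = (of_real pi * 4 ^ k / fact k :: complex)"
proof -
  have half: "Gamma (of_nat n + 1/2) = pochhammer (1/2) n * (of_real (sqrt pi) :: complex)" for n
  proof -
    have "(1/2 :: complex) \<notin> \<int>\<^sub>\<le>\<^sub>0"
      by (auto dest: nonpos_Ints_imp_Re_nonpos)
    from pochhammer_Gamma[OF this, of n] show ?thesis
      by (simp add: add.commute Gamma_one_half_complex)
  qed
  have "2 * of_nat k + 1/2 = (of_nat (2 * k) + 1/2 :: complex)"
    by simp
  then have double: "Gamma (2 * of_nat k + 1/2) = pochhammer (1/2) (2 * k) * (of_real (sqrt pi) :: complex)"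
    by (simp only: half)
  have pp: "pochhammer (1/2) (2 * k) = (4 ^ k * pochhammer (1/4) k * pochhammer (3/4) k :: complex)"
    using pochhammer_double[of "1/4 :: complex" k] by (simp add: power_mult)
  have "of_real (sqrt pi) * of_real (sqrt pi) = (of_real pi :: complex)"
    by (simp flip: of_real_mult)
  then have "Gamma (of_nat k + 1/2) * Gamma (2 * of_nat k + 1/2)
      = of_real pi * 4 ^ k * (pochhammer (1/4) k * pochhammer (3/4) k * pochhammer (1/2) k * fact k) / (fact k :: complex)"
    unfolding half double pp by (simp add: mult_ac)
  then show ?thesis
    unfolding pochhammer_quarters by simp
qed

section \<open>The kernel of the extended Gamma function on the unit interval\<close>

lemma substitution_odds:
  fixes f :: "real \<Rightarrow> 'a :: euclidean_space"
  assumes f: "set_integrable lborel {0<..} f" and cont: "continuous_on {0<..} f"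
  shows "set_integrable lborel {0<..<1} (\<lambda>s. inverse ((1 - s)\<^sup>2) *\<^sub>R f (s / (1 - s)))"
    and "(LBINT s:{0<..<1}. inverse ((1 - s)\<^sup>2) *\<^sub>R f (s / (1 - s))) = (LBINT x:{0<..}. f x)"
proof -
  let ?g = "\<lambda>s::real. s / (1 - s)"
  have img: "?g ` {0<..<1} = {0<..}"
  proof (intro equalityI subsetI)
    fix x :: real assume "x \<in> {0<..}"
    then show "x \<in> ?g ` {0<..<1}"
      by (intro image_eqI[of _ _ "x / (1 + x)"]) (auto simp: field_simps)
  qed auto
  have inj: "inj_on ?g {0<..<1}"
    by (intro inj_onI) (auto simp: field_simps)
  have der: "(?g has_field_derivative inverse ((1 - s)\<^sup>2)) (at s within {0<..<1})"
    if "s \<in> {0<..<1}" for s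
    using that by (auto intro!: derivative_eq_intros simp: field_simps power2_eq_square)
  have cont': "continuous_on {0<..<1} (\<lambda>s. inverse ((1 - s)\<^sup>2) *\<^sub>R f (s / (1 - s)))"
    by (intro continuous_intros continuous_on_compose2[OF cont]) auto
  have "f absolutely_integrable_on {0<..}"
    using f cont by (subst set_integrable_lborel_iff) auto
  moreover have "integral {0<..} f = (LBINT x:{0<..}. f x)"
    using set_borel_integral_eq_integral(2)[OF f] ..
  ultimately have 1: "(\<lambda>s. inverse ((1 - s)\<^sup>2) *\<^sub>R f (s / (1 - s))) absolutely_integrable_on {0<..<1}"
    and 2: "integral {0<..<1} (\<lambda>s. inverse ((1 - s)\<^sup>2) *\<^sub>R f (s / (1 - s))) = (LBINT x:{0<..}. f x)"
    using has_absolute_integral_change_of_variables_real[of "{0<..<1}" ?g "\<lambda>s. inverse ((1 - s)\<^sup>2)" f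
      "LBINT x:{0<..}. f x"] der inj img
    by simp_all
  show 3: "set_integrable lborel {0<..<1} (\<lambda>s. inverse ((1 - s)\<^sup>2) *\<^sub>R f (s / (1 - s)))"
    using 1 cont' by (subst (asm) set_integrable_lborel_iff) auto
  show "(LBINT s:{0<..<1}. inverse ((1 - s)\<^sup>2) *\<^sub>R f (s / (1 - s))) = (LBINT x:{0<..}. f x)"
    using set_borel_integral_eq_integral(2)[OF 3] 2 by simp
qed

lemma power_div_fact_le_exp:
  fixes y :: real
  assumes "y \<ge> 0"
  shows "y ^ n / fact n \<le> exp y"
  using sum_le_suminf[OF summable_exp_generic[of y], of "{n}"] assms
  by (simp add: exp_def field_simps)

text \<open>
  Near \<open>0\<close> the factor \<open>exp (- r / x)\<close> beats every power of \<open>x\<close>, so that \<open>p\<close> may be any real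
  number; near infinity \<open>K * sqrt x \<le> x / 2 + K\<^sup>2 / 2\<close> leaves half of the exponential decay.
  Both estimates together give a multiple of an ordinary Gamma integrand.
\<close>

lemma set_integrable_Gamma_ext_majorant:
  fixes p r K :: real
  assumes r: "r > 0"
  shows "set_integrable lborel {0<..} (\<lambda>x. x powr (p - 1) * exp (- x - r / x + K * sqrt x))"
proof -
  obtain n :: nat where "- p < real n"
    using reals_Archimedean2 by blast
  then have n: "p + real n > 0"
    by simp
  define C where "C = fact n / r ^ n * exp (K\<^sup>2 / 2)"
  let ?f = "\<lambda>x. complex_of_real x powr (of_real (p + real n) - 1) / of_real (exp (1/2 * x))"
  have "?f absolutely_integrable_on {0<..}"
    using n by (intro absolutely_integrable_Gamma_integral) auto
  then have "set_integrable lborel {0<..} ?f"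
    by (subst (asm) set_integrable_lborel_iff) (auto intro!: continuous_intros)
  then have "set_integrable lborel {0<..} (\<lambda>x. of_real C * ?f x)"
    by (intro set_integrable_mult_right)
  then show ?thesis
  proof (rule set_integrable_bound)
    show "set_borel_measurable lborel {0<..} (\<lambda>x. x powr (p - 1) * exp (- x - r / x + K * sqrt x))"
      by (intro set_borel_measurable_lborel_continuous continuous_intros) auto
    have "norm (x powr (p - 1) * exp (- x - r / x + K * sqrt x)) \<le> norm (of_real C * ?f x)"
      if x: "x > 0" for x
    proof -
      have "(r / x) ^ n / fact n \<le> exp (r / x)"
        using r x by (intro power_div_fact_le_exp) simp
      then have "exp (- (r / x)) \<le> fact n / r ^ n * x ^ n"
        using r x by (simp add: exp_minus field_simps)
      moreover have "K * sqrt x \<le> x / 2 + K\<^sup>2 / 2"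
        using zero_le_power2[of "sqrt x - K"] x by (simp add: power2_diff field_simps)
      then have "exp (K * sqrt x - x) \<le> exp (K\<^sup>2 / 2) * exp (- (x / 2))"
        by (simp flip: exp_add)
      ultimately have "exp (- (r / x)) * exp (K * sqrt x - x)
          \<le> (fact n / r ^ n * x ^ n) * (exp (K\<^sup>2 / 2) * exp (- (x / 2)))"
        using r x by (intro mult_mono) auto
      also have "\<dots> = C * x ^ n * exp (- (x / 2))"
        by (simp add: C_def)
      also have "exp (- (r / x)) * exp (K * sqrt x - x) = exp (- x - r / x + K * sqrt x)"
        by (simp flip: exp_add)
      finally have "x powr (p - 1) * exp (- x - r / x + K * sqrt x)
          \<le> x powr (p - 1) * (C * x ^ n * exp (- (x / 2)))"
        by (intro mult_left_mono) auto
      also have "\<dots> = C * x powr (p + real n - 1) * exp (- (x / 2))"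
        using x by (simp add: powr_diff powr_add powr_realpow)
      also have "\<dots> = norm (of_real C * ?f x)"
        using x r by (simp add: norm_mult norm_divide norm_powr_real_powr norm_power C_def exp_minus field_simps)
      finally show ?thesis
        by simp
    qed
    then show "AE x in lborel. x \<in> {0<..} \<longrightarrow>
        norm (x powr (p - 1) * exp (- x - r / x + K * sqrt x)) \<le> norm (of_real C * ?f x)"
      by simp
  qed
qed

definition Gamma_ext_kernel :: "complex \<Rightarrow> complex \<Rightarrow> real \<Rightarrow> complex" where
  "Gamma_ext_kernel \<rho> w x = of_real x powr (w - 1) * exp (- of_real x - \<rho> / of_real x)"

lemma norm_Gamma_ext_kernel:
  "x > 0 \<Longrightarrow> norm (Gamma_ext_kernel \<rho> w x) = x powr (Re w - 1) * exp (- x - Re \<rho> / x)"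
  by (simp add: Gamma_ext_kernel_def norm_mult norm_powr_real_powr)

lemma continuous_on_Gamma_ext_kernel:
  "continuous_on {0<..} (Gamma_ext_kernel \<rho> w)"
  unfolding Gamma_ext_kernel_def by (intro continuous_intros) auto

lemma set_integrable_Gamma_ext_kernel:
  assumes "Re \<rho> > 0"
  shows "set_integrable lborel {0<..} (Gamma_ext_kernel \<rho> w)"
proof (rule set_integrable_bound[OF set_integrable_Gamma_ext_majorant[OF assms, of "Re w" 0]])
  show "set_borel_measurable lborel {0<..} (Gamma_ext_kernel \<rho> w)"
    by (intro set_borel_measurable_lborel_continuous continuous_on_Gamma_ext_kernel) auto
qed (simp add: norm_Gamma_ext_kernel)

lemma Gamma_ext_kernel_mult_power:
  "x > 0 \<Longrightarrow> Gamma_ext_kernel \<rho> w x * of_real x ^ n = Gamma_ext_kernel \<rho> (w + of_nat n) x"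
  by (simp add: Gamma_ext_kernel_def powr_add powr_diff)

text \<open>
  The factors of the integrand that depend on \<open>s\<close> alone, for \<open>w = c + \<nu>\<close>. The next lemma
  identifies them as the pullback of \<open>Gamma_ext_kernel\<close> along \<open>x = s / (1 - s)\<close>.
\<close>

definition unit_kernel :: "complex \<Rightarrow> complex \<Rightarrow> real \<Rightarrow> complex" where
  "unit_kernel \<rho> w s = of_real s powr (w - 1) * (1 - of_real s) powr (- w - 1) *
     exp ((- (of_real s ^ 2) - \<rho> * (1 - of_real s) ^ 2) / (of_real s * (1 - of_real s)))"

lemma unit_kernel_eq:
  assumes "0 < s" "s < 1"
  shows "unit_kernel \<rho> w s = inverse ((1 - s)\<^sup>2) *\<^sub>R Gamma_ext_kernel \<rho> w (s / (1 - s))"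
proof -
  let ?s = "complex_of_real s" and ?s' = "complex_of_real (1 - s)"
  have s': "1 - ?s = ?s'"
    by simp
  have nz: "?s \<noteq> 0" "?s' \<noteq> 0"
    using assms by (auto simp del: of_real_diff)
  have ratio: "?s = complex_of_real (s / (1 - s)) * ?s'"
    using assms by simp
  have "?s powr (w - 1) = complex_of_real (s / (1 - s)) powr (w - 1) * ?s' powr (w - 1)"
    using assms by (subst ratio, subst powr_times_real) auto
  moreover have "?s' powr (w - 1) * ?s' powr (- w - 1) = ?s' powr (- 2)"
    by (simp flip: powr_add)
  moreover have "?s' powr (- 2) = inverse (?s' ^ 2)"
    using nz(2) powr_minus[of ?s' 2] powr_nat'[of ?s' 2] by (simp del: of_real_diff)
  ultimately have "?s powr (w - 1) * ?s' powr (- w - 1)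
      = inverse (?s' ^ 2) * complex_of_real (s / (1 - s)) powr (w - 1)"
    by (simp add: mult_ac del: of_real_diff)
  moreover have "(- (?s ^ 2) - \<rho> * ?s' ^ 2) / (?s * ?s')
      = - complex_of_real (s / (1 - s)) - \<rho> / complex_of_real (s / (1 - s))"
    using nz by (simp add: field_simps power2_eq_square del: of_real_diff)
  ultimately show ?thesis
    unfolding unit_kernel_def Gamma_ext_kernel_def s'
    by (simp add: scaleR_conv_of_real mult_ac del: of_real_diff)
qed

lemma continuous_on_unit_kernel: "continuous_on {0<..<1} (unit_kernel \<rho> w)"
  unfolding unit_kernel_def
  by (intro continuous_intros) (auto simp: complex_nonpos_Reals_iff complex_eq_iff)

text \<open>
  Under the substitution the factor \<open>(s / (1 - s))\<^bsup>2k\<^esup>\<close> becomes \<open>x\<^bsup>2k\<^esup>\<close> and shifts the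
  exponent of the kernel.
\<close>

lemma integral_unit_kernel_power:
  assumes "Re \<rho> > 0"
  shows "(LBINT s:{0<..<1}. unit_kernel \<rho> w s * ((of_real s / (1 - of_real s))\<^sup>2) ^ k)
    = Gamma_ext \<rho> (w + 2 * of_nat k)"
proof -
  have eq: "unit_kernel \<rho> w s * ((of_real s / (1 - of_real s))\<^sup>2) ^ k
      = inverse ((1 - s)\<^sup>2) *\<^sub>R Gamma_ext_kernel \<rho> (w + of_nat (2 * k)) (s / (1 - s))"
    if "s \<in> {0<..<1}" for s
    using that Gamma_ext_kernel_mult_power[of "s / (1 - s)" \<rho> w "2 * k"]
    by (simp add: unit_kernel_eq power_mult)
  have "(LBINT s:{0<..<1}. unit_kernel \<rho> w s * ((of_real s / (1 - of_real s))\<^sup>2) ^ k)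
      = (LBINT s:{0<..<1}. inverse ((1 - s)\<^sup>2) *\<^sub>R
          Gamma_ext_kernel \<rho> (w + of_nat (2 * k)) (s / (1 - s)))"
    using eq by (intro set_lebesgue_integral_cong) auto
  also have "\<dots> = (LBINT x:{0<..}. Gamma_ext_kernel \<rho> (w + of_nat (2 * k)) x)"
    by (intro substitution_odds(2) set_integrable_Gamma_ext_kernel continuous_on_Gamma_ext_kernel assms)
  also have "\<dots> = Gamma_ext \<rho> (w + 2 * of_nat k)"
    by (simp add: Gamma_ext_def Gamma_ext_kernel_def)
  finally show ?thesis .
qed

text \<open>
  At \<open>x = s / (1 - s)\<close> the series is at most \<open>exp (4 (\<bar>q\<bar> x\<^sup>2)\<^bsup>1/4\<^esup>) = exp (K * sqrt x)\<close>
  with \<open>K = 4 \<bar>q\<bar>\<^bsup>1/4\<^esup>\<close>, so the product is bounded by the pullback of the majorant above.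
\<close>

lemma unit_kernel_majorant:
  fixes \<rho> w q :: complex
  assumes "Re \<rho> > 0"
  obtains D where "set_integrable lborel {0<..<1} D"
    "\<And>s. 0 < s \<Longrightarrow> s < 1 \<Longrightarrow> norm (unit_kernel \<rho> w s) *
       (\<Sum>k. 256 ^ k / fact (4 * k) * (norm (q * (of_real s / (1 - of_real s))\<^sup>2)) ^ k) \<le> D s"
proof
  define K where "K = 4 * norm q powr (1/4)"
  define \<phi> where "\<phi> x = x powr (Re w - 1) * exp (- x - Re \<rho> / x + K * sqrt x)" for x
  show "set_integrable lborel {0<..<1} (\<lambda>s. inverse ((1 - s)\<^sup>2) *\<^sub>R \<phi> (s / (1 - s)))"
  proof (rule substitution_odds(1))
    show "set_integrable lborel {0<..} \<phi>"
      unfolding \<phi>_def using assms by (rule set_integrable_Gamma_ext_majorant)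
    show "continuous_on {0<..} \<phi>"
      unfolding \<phi>_def by (intro continuous_intros) auto
  qed
  fix s :: real assume s: "0 < s" "s < 1"
  define x where "x = s / (1 - s)"
  have x: "x > 0"
    using s by (simp add: x_def)
  have "norm (q * (of_real s / (1 - of_real s))\<^sup>2) = norm q * x\<^sup>2"
  proof -
    have "complex_of_real s / (1 - of_real s) = of_real x"
      by (simp add: x_def)
    then show ?thesis
      using x by (simp add: norm_mult norm_power)
  qed
  moreover have "(norm q * x\<^sup>2) powr (1/4) = norm q powr (1/4) * sqrt x"
    using x powr_powr[of x 2 "1/4"] by (simp add: powr_mult powr_half_sqrt)
  ultimately have "(\<Sum>k. 256 ^ k / fact (4 * k) * (norm (q * (of_real s / (1 - of_real s))\<^sup>2)) ^ k)
      \<le> exp (K * sqrt x)"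
    using quartic_exp_le[of "norm q * x\<^sup>2"] by (simp add: K_def mult_ac)
  then have "norm (unit_kernel \<rho> w s) *
       (\<Sum>k. 256 ^ k / fact (4 * k) * (norm (q * (of_real s / (1 - of_real s))\<^sup>2)) ^ k)
      \<le> norm (unit_kernel \<rho> w s) * exp (K * sqrt x)"
    by (intro mult_left_mono) auto
  also have "\<dots> = inverse ((1 - s)\<^sup>2) *\<^sub>R \<phi> x"
    using s x norm_Gamma_ext_kernel[OF x, of \<rho> w]
    by (simp add: unit_kernel_eq x_def[symmetric] \<phi>_def norm_mult exp_add)
  finally show "norm (unit_kernel \<rho> w s) *
       (\<Sum>k. 256 ^ k / fact (4 * k) * (norm (q * (of_real s / (1 - of_real s))\<^sup>2)) ^ k)
      \<le> inverse ((1 - s)\<^sup>2) *\<^sub>R \<phi> (s / (1 - s))"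
    by (simp add: x_def)
qed

section \<open>The Beta kernels\<close>

definition beta_kernel :: "complex \<Rightarrow> real \<Rightarrow> complex" where
  "beta_kernel \<nu> t = of_real t powr (- 1 / 2) * (1 - of_real t) powr (\<nu> - 1 / 2)"

lemma continuous_on_beta_kernel: "continuous_on {0<..<1} (beta_kernel \<nu>)"
  unfolding beta_kernel_def
  by (intro continuous_intros) (auto simp: complex_nonpos_Reals_iff)

lemma
  assumes "Re \<nu> > - 1 / 2"
  shows set_integrable_beta_kernel: "set_integrable lborel {0<..<1} (beta_kernel \<nu>)"
    and integral_beta_kernel_power:
      "(LBINT t:{0<..<1}. beta_kernel \<nu> t * of_real t ^ n) = Beta (of_nat n + 1 / 2) (\<nu> + 1 / 2)"
proof -
  have eq: "beta_kernel \<nu> t * of_real t ^ n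
      = of_real t powr (of_nat n + 1 / 2 - 1) * (1 - of_real t) powr (\<nu> + 1 / 2 - 1)"
    if "t \<in> {0<..<1}" for t n
  proof -
    have "complex_of_real t powr (of_nat n + 1 / 2 - 1) = of_real t powr (- 1 / 2) * of_real t ^ n"
      using that powr_add[of "complex_of_real t" "- 1 / 2" "of_nat n"] by (simp add: algebra_simps)
    moreover have "\<nu> + 1 / 2 - 1 = \<nu> - 1 / 2"
      by simp
    ultimately show ?thesis
      by (simp only: beta_kernel_def mult_ac)
  qed
  have "set_integrable lborel {0<..<1} (beta_kernel \<nu>) \<longleftrightarrow> set_integrable lborel {0<..<1}
      (\<lambda>t. complex_of_real t powr (1 / 2 - 1) * (1 - of_real t) powr (\<nu> + 1 / 2 - 1))"
    using eq[of _ 0] by (intro set_integrable_cong) auto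
  then show "set_integrable lborel {0<..<1} (beta_kernel \<nu>)"
    using integral_Beta_complex(1)[of "1 / 2" "\<nu> + 1 / 2"] assms by simp
  have "(LBINT t:{0<..<1}. beta_kernel \<nu> t * of_real t ^ n) =
      (LBINT t:{0<..<1}. of_real t powr (of_nat n + 1 / 2 - 1) * (1 - of_real t) powr (\<nu> + 1 / 2 - 1))"
    using eq by (intro set_lebesgue_integral_cong) auto
  also have "\<dots> = Beta (of_nat n + 1 / 2) (\<nu> + 1 / 2)"
    using assms by (intro integral_Beta_complex(2)) auto
  finally show "(LBINT t:{0<..<1}. beta_kernel \<nu> t * of_real t ^ n) = Beta (of_nat n + 1 / 2) (\<nu> + 1 / 2)" .
qed

text \<open>
  The exponent \<open>j\<close> covers both remaining integrations: the integrand depends on \<open>t\<close> through \<open>t\<close>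
  itself and on \<open>u\<close> through \<open>u\<^sup>2\<close>. On the unit interval these powers are at most \<open>1\<close>, so a
  constant multiple of the kernel is a majorant.
\<close>

lemma
  fixes a :: "nat \<Rightarrow> complex" and j :: nat
  assumes \<nu>: "Re \<nu> > - 1 / 2" and a: "summable (\<lambda>k. norm (a k))"
  shows summable_beta_kernel_moments:
      "summable (\<lambda>k. norm (a k * Beta (of_nat (j * k) + 1 / 2) (\<nu> + 1 / 2)))"
    and integral_beta_kernel_power_series: "norm y \<le> 1 \<Longrightarrow>
      (LBINT t:{0<..<1}. beta_kernel \<nu> t * (\<Sum>k. a k * (of_real t ^ j * y) ^ k))
        = (\<Sum>k. a k * Beta (of_nat (j * k) + 1 / 2) (\<nu> + 1 / 2) * y ^ k)"
proof -
  let ?D = "\<lambda>t. norm (beta_kernel \<nu> t) * (\<Sum>k. norm (a k))"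
  have D: "set_integrable lborel {0<..<1} ?D"
    using set_integrable_norm[OF set_integrable_beta_kernel[OF \<nu>]] by simp
  have le: "norm (a k) * norm (complex_of_real t ^ j) ^ k \<le> norm (a k)" if "t \<in> {0<..<1}" for t k
    using that by (intro mult_left_le) (auto simp: norm_power power_le_one)
  have sm: "summable (\<lambda>k. norm (a k) * norm (complex_of_real t ^ j) ^ k)" if "t \<in> {0<..<1}" for t
    using le[OF that] by (intro summable_comparison_test'[OF a]) auto
  have bd: "norm (beta_kernel \<nu> t) * (\<Sum>k. norm (a k) * norm (complex_of_real t ^ j) ^ k) \<le> ?D t"
    if "t \<in> {0<..<1}" for t
    using le[OF that] by (intro mult_left_mono suminf_le sm[OF that] a) auto
  have cont: "continuous_on {0<..<1} (\<lambda>t. complex_of_real t ^ j)"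
    by (intro continuous_intros)
  have mom: "(LBINT t:{0<..<1}. beta_kernel \<nu> t * (of_real t ^ j) ^ k)
      = Beta (of_nat (j * k) + 1 / 2) (\<nu> + 1 / 2)" for k
    using integral_beta_kernel_power[OF \<nu>, of "j * k"] by (simp only: power_mult)
  have S: "{0<..<1::real} \<in> sets borel"
    by simp
  show "summable (\<lambda>k. norm (a k * Beta (of_nat (j * k) + 1 / 2) (\<nu> + 1 / 2)))"
    using summable_power_series_moments[OF S continuous_on_beta_kernel cont D sm bd]
    by (simp only: mom)
  show "(LBINT t:{0<..<1}. beta_kernel \<nu> t * (\<Sum>k. a k * (of_real t ^ j * y) ^ k))
        = (\<Sum>k. a k * Beta (of_nat (j * k) + 1 / 2) (\<nu> + 1 / 2) * y ^ k)" if "norm y \<le> 1"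
    using integral_power_series[OF S continuous_on_beta_kernel cont D sm bd that]
    by (simp only: mom)
qed

section \<open>The integral representation\<close>

text \<open>
  The factor \<open>4\<^sup>k\<close> of \<open>Gamma_half_quarters\<close> turns \<open>(- b z\<^sup>2 / 16)\<^sup>k\<close> into
  \<open>(- b)\<^sup>k (z / 2)\<^bsup>2k\<^esup>\<close>. Splitting this power off \<open>(z / 2) powr (2 k + \<nu>)\<close> is where
  \<open>z \<noteq> 0\<close> enters.
\<close>

lemma Bessel_G_term_eq:
  assumes \<nu>: "Re \<nu> > - 1 / 2" and z: "z \<noteq> 0"
  shows "Bessel_G_term \<nu> b c z \<rho> k =
    (z / 2) powr \<nu> / (Gamma c * of_real pi * (Gamma (\<nu> + 1 / 2)) ^ 2) *
    (256 ^ k / fact (4 * k) * (- b * z ^ 2 / 16) ^ k * Gamma_ext \<rho> (c + \<nu> + 2 * of_nat k) *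
     Beta (of_nat k + 1 / 2) (\<nu> + 1 / 2) * Beta (of_nat (2 * k) + 1 / 2) (\<nu> + 1 / 2))"
proof -
  have G: "Gamma (\<nu> + 1 / 2) \<noteq> 0"
    using \<nu> Gamma_eq_zero_iff[of "\<nu> + 1 / 2"] by (auto dest!: nonpos_Ints_imp_Re_nonpos)
  have pi: "complex_of_real pi \<noteq> 0"
    by simp
  let ?g = "Gamma (\<nu> + 1 / 2)" and ?g1 = "Gamma (\<nu> + of_nat k + 1)" and ?g2 = "Gamma (\<nu> + 2 * of_nat k + 1)"
    and ?h1 = "Gamma (of_nat k + 1 / 2 :: complex)" and ?h2 = "Gamma (2 * of_nat k + 1 / 2 :: complex)"
  have beta: "Beta (of_nat k + 1 / 2) (\<nu> + 1 / 2) = ?h1 * ?g / ?g1"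
    "Beta (of_nat (2 * k) + 1 / 2) (\<nu> + 1 / 2) = ?h2 * ?g / ?g2"
    by (simp_all add: Beta_def add_ac)
  have pw: "(z / 2) powr (2 * of_nat k + \<nu>) = (z\<^sup>2 / 4) ^ k * (z / 2) powr \<nu>"
  proof -
    have "2 * of_nat k = (of_nat (2 * k) :: complex)"
      by simp
    then have "(z / 2) powr (2 * of_nat k) = (z / 2) ^ (2 * k)"
      using z by (simp only:) (subst powr_complexpow, auto)
    then show ?thesis
      by (simp add: powr_add power_mult power_divide)
  qed
  have "(256 ^ k / fact (4 * k) * (- b * z ^ 2 / 16) ^ k * Gamma_ext \<rho> (c + \<nu> + 2 * of_nat k) *
     Beta (of_nat k + 1 / 2) (\<nu> + 1 / 2) * Beta (of_nat (2 * k) + 1 / 2) (\<nu> + 1 / 2))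
     = (256 ^ k / fact (4 * k) * (?h1 * ?h2)) * (- b * z ^ 2 / 16) ^ k *
        Gamma_ext \<rho> (c + \<nu> + 2 * of_nat k) * ?g\<^sup>2 / (?g1 * ?g2)"
    unfolding beta by (simp add: power2_eq_square[of ?g] mult_ac)
  also have "\<dots> = of_real pi * ?g\<^sup>2 * ((4 ^ k * (- b * z ^ 2 / 16) ^ k) *
        Gamma_ext \<rho> (c + \<nu> + 2 * of_nat k) / (?g1 * ?g2 * fact k))"
    unfolding Gamma_half_quarters by (simp add: mult_ac)
  also have "4 ^ k * (- b * z ^ 2 / 16) ^ k = (- b) ^ k * (z\<^sup>2 / 4) ^ k"
    by (simp flip: power_mult_distrib)
  finally show ?thesis
    unfolding Bessel_G_term_def pochhammer_ext_def pw
    using G pi by (simp add: field_simps)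
qed

theorem theorem5p1:
  fixes b c \<nu> \<rho> z :: complex
  assumes "Re c > 0" and "Re \<nu> > - 1 / 2" and "Re \<rho> > 0"
    and "z \<notin> \<real>\<^sub>\<le>\<^sub>0"
  shows "let F = (\<lambda>s t u :: complex.
           t powr (- 1 / 2) * u powr (- 1 / 2) * s powr (c + \<nu> - 1) *
           (1 - t) powr (\<nu> - 1 / 2) * (1 - u) powr (\<nu> - 1 / 2) * (1 - s) powr (- c - \<nu> - 1) *
           exp ((- (s ^ 2) - \<rho> * (1 - s) ^ 2) / (s * (1 - s))) *
           hypergeom_0F3 (1 / 4) (3 / 4) (1 / 2)
             (- b * z ^ 2 * s ^ 2 * u ^ 2 * t / (16 * (1 - s) ^ 2)))
         in summable (Bessel_G_term \<nu> b c z \<rho>) \<and>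
            set_integrable lborel ({0<..<1} \<times> {0<..<1} \<times> {0<..<1})
              (\<lambda>(s :: real, t :: real, u :: real). F (of_real s) (of_real t) (of_real u)) \<and>
            Bessel_G \<nu> b c z \<rho> =
              (z / 2) powr \<nu> / (Gamma c * of_real pi * (Gamma (\<nu> + 1 / 2)) ^ 2) *
              (LBINT u:{0<..<1}. LBINT t:{0<..<1}. LBINT s:{0<..<1}.
                 F (of_real s) (of_real t) (of_real u))"
proof -
  define F where "F = (\<lambda>s t u :: complex.
           t powr (- 1 / 2) * u powr (- 1 / 2) * s powr (c + \<nu> - 1) *
           (1 - t) powr (\<nu> - 1 / 2) * (1 - u) powr (\<nu> - 1 / 2) * (1 - s) powr (- c - \<nu> - 1) *
           exp ((- (s ^ 2) - \<rho> * (1 - s) ^ 2) / (s * (1 - s))) *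
           hypergeom_0F3 (1 / 4) (3 / 4) (1 / 2)
             (- b * z ^ 2 * s ^ 2 * u ^ 2 * t / (16 * (1 - s) ^ 2)))"
  define q where "q = - b * z ^ 2 / 16"
  define w where "w = c + \<nu>"
  define P where "P = (z / 2) powr \<nu> / (Gamma c * of_real pi * (Gamma (\<nu> + 1 / 2)) ^ 2)"
  let ?I = "{0<..<1::real}"
  let ?H = "hypergeom_0F3 (1/4) (3/4) (1/2)"
  let ?h = "unit_kernel \<rho> w" and ?B = "beta_kernel \<nu>"
  let ?X = "\<lambda>s::real. (of_real s / (1 - of_real s) :: complex)\<^sup>2"
  \<comment> \<open>The coefficients before any integration and after those over \<open>s\<close>, \<open>t\<close> and \<open>u\<close>.\<close>
  define a\<^sub>0 where "a\<^sub>0 = (\<lambda>k. 256 ^ k / fact (4 * k) * q ^ k)"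
  define a\<^sub>1 where "a\<^sub>1 = (\<lambda>k. a\<^sub>0 k * Gamma_ext \<rho> (w + 2 * of_nat k))"
  define a\<^sub>2 where "a\<^sub>2 = (\<lambda>k. a\<^sub>1 k * Beta (of_nat k + 1 / 2) (\<nu> + 1 / 2))"
  define a\<^sub>3 where "a\<^sub>3 = (\<lambda>k. a\<^sub>2 k * Beta (of_nat (2 * k) + 1 / 2) (\<nu> + 1 / 2))"
  note \<nu> = assms(2) and \<rho> = assms(3)

  have F_eq: "F (of_real s) (of_real t) (of_real u)
      = ?B t * ?B u * (?h s * ?H (q * ?X s * (of_real t * of_real u ^ 2)))" for s t u :: real
    by (simp add: F_def q_def w_def unit_kernel_def beta_kernel_def power_divide mult_ac)
  have H_eq: "?H (q * x) = (\<Sum>k. a\<^sub>0 k * x ^ k)" for x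
    unfolding hypergeom_0F3_quarters a\<^sub>0_def by (simp add: power_mult_distrib mult_ac)
  obtain D where D: "set_integrable lborel ?I D"
    and D_le: "\<And>s. 0 < s \<Longrightarrow> s < 1 \<Longrightarrow> norm (?h s) *
       (\<Sum>k. 256 ^ k / fact (4 * k) * (norm (q * ?X s)) ^ k) \<le> D s"
    using unit_kernel_majorant[OF \<rho>, where w = w and q = q] by blast

  have norm_a\<^sub>0: "norm (a\<^sub>0 k) * norm x ^ k = 256 ^ k / fact (4 * k) * norm (q * x) ^ k" for k x
    by (simp add: a\<^sub>0_def norm_mult norm_divide norm_power power_mult_distrib)
  have S: "?I \<in> sets borel"
    by simp
  have contX: "continuous_on ?I ?X"
    by (intro continuous_intros) (auto simp: complex_eq_iff)
  have sm: "summable (\<lambda>k. norm (a\<^sub>0 k) * norm (?X s) ^ k)" for s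
    unfolding norm_a\<^sub>0 by (intro summable_quartic_exp) simp
  have bd: "norm (?h s) * (\<Sum>k. norm (a\<^sub>0 k) * norm (?X s) ^ k) \<le> D s" if "s \<in> ?I" for s
    unfolding norm_a\<^sub>0 using D_le that by simp
  note s_series = S continuous_on_unit_kernel contX D sm bd
  have a\<^sub>1: "summable (\<lambda>k. norm (a\<^sub>1 k))"
    using summable_power_series_moments[OF s_series] \<rho>
    by (simp only: a\<^sub>1_def integral_unit_kernel_power)
  have a\<^sub>2: "summable (\<lambda>k. norm (a\<^sub>2 k))"
    using summable_beta_kernel_moments[OF \<nu> a\<^sub>1, of 1] by (simp only: a\<^sub>2_def mult_1)
  have a\<^sub>3: "summable (\<lambda>k. norm (a\<^sub>3 k))"
    unfolding a\<^sub>3_def by (rule summable_beta_kernel_moments[OF \<nu> a\<^sub>2])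
  have term_eq: "Bessel_G_term \<nu> b c z \<rho> = (\<lambda>k. P * a\<^sub>3 k)"
    unfolding P_def a\<^sub>3_def a\<^sub>2_def a\<^sub>1_def a\<^sub>0_def q_def w_def
    using assms(4) by (intro ext Bessel_G_term_eq \<nu>) auto

  have int_s: "(LBINT s:?I. F (of_real s) (of_real t) (of_real u))
      = ?B u * (?B t * (\<Sum>k. a\<^sub>1 k * (of_real t ^ 1 * of_real u ^ 2) ^ k))"
    if t: "t \<in> ?I" and u: "u \<in> ?I" for t u
  proof -
    have y: "norm (complex_of_real t * of_real u ^ 2) \<le> 1"
      using t u by (auto simp: norm_mult norm_power intro!: mult_le_one power_le_one)
    have "(LBINT s:?I. F (of_real s) (of_real t) (of_real u))
        = (LBINT s:?I. ?B u * ?B t * (?h s * (\<Sum>k. a\<^sub>0 k * (?X s * (of_real t * of_real u ^ 2)) ^ k)))"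
      by (simp only: F_eq H_eq[symmetric] mult_ac)
    also have "\<dots> = ?B u * ?B t * (LBINT s:?I. ?h s * (\<Sum>k. a\<^sub>0 k * (?X s * (of_real t * of_real u ^ 2)) ^ k))"
      by (rule set_integral_mult_right)
    also have "\<dots> = ?B u * ?B t * (\<Sum>k. a\<^sub>1 k * (of_real t * of_real u ^ 2) ^ k)"
      using integral_power_series[OF s_series y] \<rho>
      by (simp only: a\<^sub>1_def integral_unit_kernel_power)
    finally show ?thesis
      by (simp only: power_one_right mult.assoc)
  qed
  have int_t: "(LBINT t:?I. LBINT s:?I. F (of_real s) (of_real t) (of_real u))
      = ?B u * (\<Sum>k. a\<^sub>2 k * (of_real u ^ 2 * 1) ^ k)" if u: "u \<in> ?I" for u
  proof -
    have y: "norm (complex_of_real u ^ 2) \<le> 1"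
      using u by (auto simp: norm_power intro!: power_le_one)
    have "(LBINT t:?I. LBINT s:?I. F (of_real s) (of_real t) (of_real u))
        = (LBINT t:?I. ?B u * (?B t * (\<Sum>k. a\<^sub>1 k * (of_real t ^ 1 * of_real u ^ 2) ^ k)))"
      using int_s u by (intro set_lebesgue_integral_cong) auto
    also have "\<dots> = ?B u * (LBINT t:?I. ?B t * (\<Sum>k. a\<^sub>1 k * (of_real t ^ 1 * of_real u ^ 2) ^ k))"
      by (rule set_integral_mult_right)
    also have "\<dots> = ?B u * (\<Sum>k. a\<^sub>2 k * (of_real u ^ 2 * 1) ^ k)"
      using integral_beta_kernel_power_series[OF \<nu> a\<^sub>1 y, of 1] by (simp only: a\<^sub>2_def mult_1_right mult_1)
    finally show ?thesis .
  qed
  have "(LBINT u:?I. LBINT t:?I. LBINT s:?I. F (of_real s) (of_real t) (of_real u))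
      = (LBINT u:?I. ?B u * (\<Sum>k. a\<^sub>2 k * (of_real u ^ 2 * 1) ^ k))"
    using int_t by (intro set_lebesgue_integral_cong) auto
  also have "\<dots> = (\<Sum>k. a\<^sub>3 k)"
    using integral_beta_kernel_power_series[OF \<nu> a\<^sub>2, of 1 2] by (simp add: a\<^sub>3_def)
  finally have int_u: "(LBINT u:?I. LBINT t:?I. LBINT s:?I. F (of_real s) (of_real t) (of_real u))
      = (\<Sum>k. a\<^sub>3 k)" .

  have "summable a\<^sub>3"
    using a\<^sub>3 by (rule summable_norm_cancel)
  then have summable: "summable (Bessel_G_term \<nu> b c z \<rho>)"
    and sum: "Bessel_G \<nu> b c z \<rho> = P * (\<Sum>k. a\<^sub>3 k)"
    unfolding Bessel_G_def term_eq by (simp_all add: suminf_mult summable_mult)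

  have integrable: "set_integrable lborel (?I \<times> ?I \<times> ?I)
      (\<lambda>(s :: real, t :: real, u :: real). F (of_real s) (of_real t) (of_real u))"
    (is "set_integrable _ _ ?F")
  proof -
    let ?n = "\<lambda>t. indicator ?I t * norm (?B t)"
    let ?d = "\<lambda>s. indicator ?I s * D s"
    have n: "integrable lborel ?n"
      using set_integrable_norm[OF set_integrable_beta_kernel[OF \<nu>]] by (simp add: set_integrable_def)
    have d: "integrable lborel ?d"
      using D by (simp add: set_integrable_def)
    have nn: "integrable lborel (\<lambda>(t, u). ?n t * ?n u)"
      using lborel_pair.integrable_mult_prod[OF n n] by (simp only: lborel_prod)
    have "integrable lborel (\<lambda>(s, p). ?d s * (case p of (t, u) \<Rightarrow> ?n t * ?n u))"
      using lborel_pair.integrable_mult_prod[OF d nn] by (simp only: lborel_prod)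
    then have prod: "integrable lborel (\<lambda>(s, t, u). ?d s * (?n t * ?n u))"
      by (simp add: case_prod_unfold)
    show ?thesis
      unfolding set_integrable_def
    proof (rule Bochner_Integration.integrable_bound[OF prod])
      have "continuous_on (?I \<times> ?I \<times> ?I) ?F"
        unfolding F_def case_prod_unfold
        by (intro continuous_intros continuous_on_hypergeom_0F3_quarters)
          (auto simp: complex_nonpos_Reals_iff complex_eq_iff)
      then show "(\<lambda>p. indicat_real (?I \<times> ?I \<times> ?I) p *\<^sub>R ?F p) \<in> borel_measurable lborel"
        using borel_measurable_continuous_on_indicator[of "?I \<times> ?I \<times> ?I" ?F]
        by (simp add: borel_open open_Times)
      have "norm (?F (s, t, u)) \<le> D s * (norm (?B t) * norm (?B u))"
        if "s \<in> ?I" "t \<in> ?I" "u \<in> ?I" for s t u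
      proof -
        have y: "norm (complex_of_real t * of_real u ^ 2) \<le> 1"
          using that by (auto simp: norm_mult norm_power intro!: mult_le_one power_le_one)
        have "norm (?h s) * norm (?H (q * ?X s * (of_real t * of_real u ^ 2)))
            \<le> norm (?h s) * (\<Sum>k. 256 ^ k / fact (4 * k) * norm (q * ?X s) ^ k)"
          using y by (intro mult_left_mono norm_hypergeom_0F3_quarters_le)
            (auto simp: norm_mult[of "q * _"] intro: mult_left_le)
        also have "\<dots> \<le> D s"
          using D_le that by simp
        finally have "norm (?h s) * norm (?H (q * ?X s * (of_real t * of_real u ^ 2))) \<le> D s" .
        then have "norm (?h s) * norm (?H (q * ?X s * (of_real t * of_real u ^ 2))) * (norm (?B t) * norm (?B u))
            \<le> D s * (norm (?B t) * norm (?B u))"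
          by (rule mult_right_mono) simp
        then show ?thesis
          unfolding prod.case F_eq norm_mult by (simp only: mult_ac)
      qed
      then show "AE p in lborel. norm (indicat_real (?I \<times> ?I \<times> ?I) p *\<^sub>R ?F p)
          \<le> norm (case p of (s, t, u) \<Rightarrow> ?d s * (?n t * ?n u))"
        by (intro AE_I2) (force simp: indicator_def intro: order_trans[OF _ abs_ge_self])
    qed
  qed
  show ?thesis
    unfolding Let_def F_def[symmetric]
    using summable integrable sum int_u by (simp add: P_def)
qed

end
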